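(* Let $n\ge1$ be an integer and let $\alpha_0,\dots,\alpha_n\in\mathbb{C}$ with $\alpha_n\neq0$. Let $\beta_1,\dots,\beta_n$ be the $n$ complex roots (listed with multiplicity) of the equation $\sum_{i=0}^{n}\alpha_iX^i=0$. The causal Green's function of the linear differential operator $$\mathcal{O}(x,\partial_x)=\sum_{k=0}^{n}\alpha_k\,\partial_x^k$$ is $$G(x,y)=\frac{\theta(x-y)}{\alpha_n}\int_y^xdz_1\int_y^{z_1}dz_2\cdots\int_y^{z_{n-2}}dz_{n-1}\;e^{\beta_1(x-z_1)+\beta_2(z_1-z_2)+\cdots+\beta_n(z_{n-1}-y)}.$$
   Context: Functions are complex-valued functions of a real variable, considered on an arbitrary interval $[a,b]$ with $a<b$ real. $\theta$ is the Heaviside step function: $\theta(t)=1$ for $t>0$ and $\theta(t)=0$ for $t<0$ (the value at $0$ is immaterial; take $\theta(0)=1$). Integrals are oriented. For $n=1$ there is no integration over $z$'s and the formula reads $G(x,y)=\frac{\theta(x-y)}{\alpha_1}e^{\beta_1(x-y)}$. Causal Green's function: for a linear differential operator $\mathcal{O}(x,\partial_x)$ of order $n\ge1$ with constant leading coefficient $\alpha_n\ne0$ and continuous coefficients on $[a,b]$, its causal Green's function (the Green's function for the boundary condition $\partial_x^i y(a)=0$, $i=0,\dots,n-1$) is the function $G(x,y)=T(x,y)\theta(x-y)$ on $[a,b]\times[a,b]$ where, for each fixed $y\in[a,b]$, $T(\cdot,y)$ is the unique $n$ times continuously differentiable function on $[a,b]$ with $\mathcal{O}(x,\partial_x)T(x,y)=0$,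 $(\partial_x^iT(x,y))|_{x=y}=0$ for $i=0,\dots,n-2$, and $(\partial_x^{n-1}T(x,y))|_{x=y}=1/\alpha_n$. *)

theory Defs
  imports "HOL-Analysis.Analysis" "HOL-Computational_Algebra.Computational_Algebra"
begin

definition heaviside :: "real \<Rightarrow> real" where
  "heaviside t = (if t \<ge> 0 then 1 else 0)"

text \<open>Derivatives on \<open>[a, b]\<close> are taken within the interval, hence are one-sided at the endpoints.
  For \<open>x\<close> in the interval (and \<open>a < b\<close>), \<open>nderiv a b k f x\<close> depends only on \<open>f\<close> restricted to
  \<open>[a, b]\<close>; it is meaningful when \<open>f\<close> is \<open>k\<close> times differentiable there.\<close>

definition deriv_within :: "real \<Rightarrow> real \<Rightarrow> (real \<Rightarrow> complex) \<Rightarrow> real \<Rightarrow> complex" where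
  "deriv_within a b f x = vector_derivative f (at x within {a..b})"

definition nderiv :: "real \<Rightarrow> real \<Rightarrow> nat \<Rightarrow> (real \<Rightarrow> complex) \<Rightarrow> real \<Rightarrow> complex" where
  "nderiv a b k f = (deriv_within a b ^^ k) f"

definition C_k_on :: "nat \<Rightarrow> real \<Rightarrow> real \<Rightarrow> (real \<Rightarrow> complex) \<Rightarrow> bool" where
  "C_k_on n a b f \<longleftrightarrow>
     (\<forall>k<n. nderiv a b k f differentiable_on {a..b}) \<and> continuous_on {a..b} (nderiv a b n f)"

text \<open>A linear differential operator of order \<open>n\<close> is given by its coefficient functions
  \<open>c 0, \<dots>, c n\<close>.\<close>

definition lin_diff_op ::
    "real \<Rightarrow> real \<Rightarrow> nat \<Rightarrow> (nat \<Rightarrow> real \<Rightarrow> complex) \<Rightarrow> (real \<Rightarrow> complex) \<Rightarrow> real \<Rightarrow> complex" where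
  "lin_diff_op a b n c f x = (\<Sum>k\<le>n. c k x * nderiv a b k f x)"

definition admissible_coeffs :: "real \<Rightarrow> real \<Rightarrow> nat \<Rightarrow> (nat \<Rightarrow> real \<Rightarrow> complex) \<Rightarrow> bool" where
  "admissible_coeffs a b n c \<longleftrightarrow>
     n \<ge> 1 \<and> (\<forall>k\<le>n. continuous_on {a..b} (c k)) \<and>
     (\<exists>A. A \<noteq> 0 \<and> (\<forall>x\<in>{a..b}. c n x = A))"

text \<open>The leading coefficient is constant, so \<open>c n y\<close> below is just that constant.\<close>

definition causal_ivp ::
    "real \<Rightarrow> real \<Rightarrow> nat \<Rightarrow> (nat \<Rightarrow> real \<Rightarrow> complex) \<Rightarrow> real \<Rightarrow> (real \<Rightarrow> complex) \<Rightarrow> bool" where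
  "causal_ivp a b n c y f \<longleftrightarrow>
     C_k_on n a b f \<and>
     (\<forall>x\<in>{a..b}. lin_diff_op a b n c f x = 0) \<and>
     (\<forall>i. i + 1 < n \<longrightarrow> nderiv a b i f y = 0) \<and>
     nderiv a b (n - 1) f y = 1 / c n y"

text \<open>Uniqueness of \<open>T(\<cdot>, y)\<close> is uniqueness as a function on \<open>[a, b]\<close>; likewise only the values of
  \<open>G\<close> on the square are constrained.\<close>

definition causal_greens_function ::
    "real \<Rightarrow> real \<Rightarrow> nat \<Rightarrow> (nat \<Rightarrow> real \<Rightarrow> complex) \<Rightarrow> (real \<Rightarrow> real \<Rightarrow> complex) \<Rightarrow> bool" where
  "causal_greens_function a b n c G \<longleftrightarrow>
     a < b \<and> admissible_coeffs a b n c \<and>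
     (\<exists>T. \<forall>y\<in>{a..b}.
        causal_ivp a b n c y (\<lambda>x. T x y) \<and>
        (\<forall>f. causal_ivp a b n c y f \<longrightarrow> (\<forall>x\<in>{a..b}. f x = T x y)) \<and>
        (\<forall>x\<in>{a..b}. G x y = T x y * of_real (heaviside (x - y))))"

text \<open>Oriented integration over \<open>m\<close> nested variables: \<open>z\<^sub>1\<close> runs from \<open>y\<close> to \<open>x\<close>, each \<open>z\<^sub>i\<^sub>+\<^sub>1\<close>
  from \<open>y\<close> to \<open>z\<^sub>i\<close>; the integrand receives the list \<open>[z\<^sub>1, \<dots>, z\<^sub>m]\<close>.\<close>

primrec iterated_integral :: "nat \<Rightarrow> real \<Rightarrow> real \<Rightarrow> (real list \<Rightarrow> complex) \<Rightarrow> complex" where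
  "iterated_integral 0 y x F = F []"
| "iterated_integral (Suc m) y x F =
     (LBINT z=ereal y..ereal x. iterated_integral m y z (\<lambda>zs. F (z # zs)))"

end

theory Submission
  imports Defs
begin

text \<open>The operator factors as \<open>\<alpha>\<^sub>n (D - \<beta>\<^sub>1) \<cdots> (D - \<beta>\<^sub>n)\<close>, where \<open>D\<close> is differentiation, and both
  halves of the claim, existence and uniqueness, are obtained by peeling off one factor at a time.

  Read from the outside in, the iterated integral is a convolution of exponentials: writing
  \<open>E\<^sub>j\<close> for the integral that involves only \<open>\<beta>\<^sub>j, \<dots>, \<beta>\<^sub>n\<close>, one has
  \<open>E\<^sub>n(x) = exp (\<beta>\<^sub>n (x - y))\<close> and \<open>E\<^sub>j(x)\<close> is the integral from \<open>y\<close> to \<open>x\<close> of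
  \<open>exp (\<beta>\<^sub>j (x - z)) E\<^sub>j\<^sub>+\<^sub>1(z)\<close> (\<open>iterated_integral_eq_exp_chain\<close>). By the fundamental theorem of
  calculus \<open>(D - \<beta>\<^sub>j) E\<^sub>j = E\<^sub>j\<^sub>+\<^sub>1\<close> (\<open>exp_chain_Suc_has_vector_derivative\<close>), while
  \<open>(D - \<beta>\<^sub>n) E\<^sub>n = 0\<close>. Hence the whole product annihilates \<open>E\<^sub>1\<close>
  (\<open>root_poly_annihilates_chain\<close>), and the same recursion shows that at \<open>x = y\<close> the derivatives of
  \<open>E\<^sub>1\<close> of order below \<open>n - 1\<close> vanish and the one of order \<open>n - 1\<close> is \<open>1\<close>
  (\<open>chain_deriv_initial\<close>). So \<open>T = E\<^sub>1 / \<alpha>\<^sub>n\<close> solves the initial value problem.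

  For uniqueness, let \<open>h\<close> be a difference of two solutions. Then
  \<open>u = (D - \<beta>\<^sub>2) \<cdots> (D - \<beta>\<^sub>n) h\<close> satisfies \<open>u' = \<beta>\<^sub>1 u\<close> and \<open>u(y) = 0\<close>, so \<open>u = 0\<close>; thus \<open>h\<close>
  solves a homogeneous problem of lower order, and induction gives \<open>h = 0\<close>
  (\<open>homogeneous_ivp_zero\<close>).\<close>

section \<open>Polynomials in the derivative\<close>

text \<open>A differential operator \<open>p(D)\<close> is evaluated at a point by pairing the coefficients of \<open>p\<close> with the
  sequence \<open>s\<close> of values \<open>f(x), f'(x), f''(x), \<dots>\<close>. Working with sequences separates the algebra of
  operators from questions of differentiability: composing with \<open>D\<close> on the right becomes a shift
  of \<open>s\<close>.\<close>

definition apply_poly :: "complex poly \<Rightarrow> (nat \<Rightarrow> complex) \<Rightarrow> complex" where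
  "apply_poly p s = (\<Sum>k\<le>degree p. coeff p k * s k)"

lemma apply_poly_bound:
  assumes "degree p \<le> N"
  shows "apply_poly p s = (\<Sum>k\<le>N. coeff p k * s k)"
  unfolding apply_poly_def
  by (rule sum.mono_neutral_left) (use assms in \<open>auto simp: coeff_eq_0\<close>)

lemma apply_poly_smult: "apply_poly (smult c p) s = c * apply_poly p s"
  by (subst apply_poly_bound[of _ "degree p"])
     (auto simp: apply_poly_def sum_distrib_left mult_ac degree_smult_le)

lemma apply_poly_diff: "apply_poly p (\<lambda>k. s k - t k) = apply_poly p s - apply_poly p t"
  by (simp add: apply_poly_def algebra_simps sum_subtractf)

lemma apply_poly_scale: "apply_poly p (\<lambda>k. c * s k) = c * apply_poly p s"
  by (simp add: apply_poly_def sum_distrib_left mult_ac)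

text \<open>The step that peels off a factor: \<open>q(D) (D - c) f = q(D) f' - c q(D) f\<close>. The right-hand side can be
  read as \<open>q(D)\<close> applied to \<open>f' - c f\<close>, which is what existence uses, or as \<open>u' - c u\<close> for
  \<open>u = q(D) f\<close>, which is what uniqueness uses.\<close>

lemma apply_poly_linear_factor_mult:
  "apply_poly ([:-c, 1:] * q) s = apply_poly q (\<lambda>k. s (Suc k)) - c * apply_poly q s"
proof -
  let ?N = "Suc (degree q)"
  have "degree ([:-c, 1:] * q) \<le> ?N"
    using degree_mult_le[of "[:-c, 1:]" q] by simp
  hence "apply_poly ([:-c, 1:] * q) s = (\<Sum>k\<le>?N. coeff ([:-c, 1:] * q) k * s k)"
    by (rule apply_poly_bound)
  also have "\<dots> = (\<Sum>k\<le>?N. coeff (pCons 0 q) k * s k) - c * (\<Sum>k\<le>?N. coeff q k * s k)"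
    by (simp add: algebra_simps sum_subtractf sum_distrib_left del: sum.atMost_Suc)
  also have "(\<Sum>k\<le>?N. coeff (pCons 0 q) k * s k) = apply_poly q (\<lambda>k. s (Suc k))"
    by (subst sum.atMost_Suc_shift) (simp add: apply_poly_def)
  also have "(\<Sum>k\<le>?N. coeff q k * s k) = apply_poly q s"
    by (rule apply_poly_bound[symmetric]) simp
  finally show ?thesis .
qed

definition root_poly :: "nat \<Rightarrow> (nat \<Rightarrow> complex) \<Rightarrow> complex poly" where
  "root_poly m b = (\<Prod>i<m. [:- b i, 1:])"

lemma root_poly_0 [simp]: "root_poly 0 b = 1"
  by (simp add: root_poly_def)

lemma root_poly_Suc: "root_poly (Suc m) b = [:- b 0, 1:] * root_poly m (b \<circ> Suc)"
  unfolding root_poly_def by (subst prod.lessThan_Suc_shift) simp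

lemma degree_root_poly [simp]: "degree (root_poly m b) = m"
  unfolding root_poly_def by (subst degree_prod_sum_eq) auto

section \<open>Towers of derivatives on an interval\<close>

text \<open>The iterated derivative \<open>nderiv\<close> is built from a choice operator, which makes it awkward to compute
  with. A sequence of functions, each the derivative of the one before, must coincide with the iterated
  derivatives of its first member (\<open>nderiv_eq_tower\<close>), and conversely the iterated derivatives of a \<open>C\<^sup>n\<close> function form such a sequence
  (\<open>tower_of_C_k_on\<close>); all calculus is therefore done on towers.\<close>

definition derivative_tower ::
    "real \<Rightarrow> real \<Rightarrow> nat \<Rightarrow> (nat \<Rightarrow> real \<Rightarrow> complex) \<Rightarrow> bool" where
  "derivative_tower a b n s \<longleftrightarrow>
     (\<forall>k<n. \<forall>x\<in>{a..b}. (s k has_vector_derivative s (Suc k) x) (at x within {a..b}))"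

lemma derivative_tower_mono:
  "derivative_tower a b n s \<Longrightarrow> m \<le> n \<Longrightarrow> derivative_tower a b m s"
  by (auto simp: derivative_tower_def)

lemma derivative_tower_diff:
  "derivative_tower a b n s \<Longrightarrow> derivative_tower a b n t \<Longrightarrow>
   derivative_tower a b n (\<lambda>k x. s k x - t k x)"
  by (auto simp: derivative_tower_def intro!: derivative_intros)

lemma apply_poly_has_vector_derivative:
  assumes "derivative_tower a b n s" "degree q < n" "x \<in> {a..b}"
  shows "((\<lambda>x. apply_poly q (\<lambda>k. s k x)) has_vector_derivative
            apply_poly q (\<lambda>k. s (Suc k) x)) (at x within {a..b})"
  unfolding apply_poly_def
  by (intro has_vector_derivative_sum has_vector_derivative_mult_right)
     (use assms in \<open>auto simp: derivative_tower_def\<close>)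

lemma nderiv_0: "nderiv a b 0 f = f"
  by (simp add: nderiv_def)

lemma nderiv_Suc:
  "nderiv a b (Suc k) f x = vector_derivative (nderiv a b k f) (at x within {a..b})"
  by (simp add: nderiv_def deriv_within_def)

text \<open>Since \<open>nderiv\<close> only sees the function within the interval, the equality proved so far on \<open>{a..b}\<close> is
  enough to transfer the next derivative; \<open>a < b\<close> makes that one-sided derivative unique.\<close>

lemma nderiv_eq_tower:
  assumes "a < b" "derivative_tower a b n s" "k \<le> n" "x \<in> {a..b}"
  shows "nderiv a b k (s 0) x = s k x"
  using assms(3,4)
proof (induction k arbitrary: x)
  case 0
  thus ?case by (simp add: nderiv_0)
next
  case (Suc k)
  have "(s k has_vector_derivative s (Suc k) x) (at x within {a..b})"
    using assms(2) Suc.prems by (auto simp: derivative_tower_def)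
  hence "(nderiv a b k (s 0) has_vector_derivative s (Suc k) x) (at x within {a..b})"
    by (rule has_vector_derivative_transform[rotated 2]) (use Suc in auto)
  thus ?case
    unfolding nderiv_Suc
    by (intro vector_derivative_within_closed_interval) (use assms(1) Suc.prems in auto)
qed

lemma C_k_on_tower:
  assumes "a < b" "derivative_tower a b n s" "continuous_on {a..b} (s n)"
  shows "C_k_on n a b (s 0)"
  unfolding C_k_on_def
proof (intro conjI allI impI)
  note eq = nderiv_eq_tower[OF assms(1,2)]
  show "nderiv a b k (s 0) differentiable_on {a..b}" if "k < n" for k
    unfolding differentiable_on_def
  proof
    fix x assume x: "x \<in> {a..b}"
    have "(s k has_vector_derivative s (Suc k) x) (at x within {a..b})"
      using assms(2) that x by (auto simp: derivative_tower_def)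
    hence "(nderiv a b k (s 0) has_vector_derivative s (Suc k) x) (at x within {a..b})"
      by (rule has_vector_derivative_transform[rotated 2]) (use eq that x in auto)
    thus "nderiv a b k (s 0) differentiable at x within {a..b}"
      by (rule differentiableI_vector)
  qed
  show "continuous_on {a..b} (nderiv a b n (s 0))"
    using assms(3) by (subst continuous_on_cong[OF refl eq]) auto
qed

lemma tower_of_C_k_on:
  "C_k_on n a b f \<Longrightarrow> derivative_tower a b n (\<lambda>k. nderiv a b k f)"
  by (auto simp: C_k_on_def derivative_tower_def nderiv_Suc differentiable_on_def
      vector_derivative_works[symmetric])

section \<open>Uniqueness\<close>

text \<open>The integrating factor \<open>exp (- c x)\<close> turns \<open>u\<close> into a function with zero derivative.\<close>

lemma first_order_ode_zero:
  fixes u :: "real \<Rightarrow> complex"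
  assumes u: "\<And>x. x \<in> {a..b} \<Longrightarrow> (u has_vector_derivative c * u x) (at x within {a..b})"
    and "y \<in> {a..b}" "u y = 0" "x \<in> {a..b}"
  shows "u x = 0"
proof -
  let ?v = "\<lambda>x. exp (- c * of_real x) * u x"
  have "(?v has_vector_derivative 0) (at x within {a..b})" if x: "x \<in> {a..b}" for x
  proof -
    have "((\<lambda>x::real. exp (- c * of_real x)) has_vector_derivative
             - c * exp (- c * of_real x)) (at x within {a..b})"
      by (rule has_vector_derivative_real_field) (auto intro!: derivative_eq_intros)
    from has_vector_derivative_mult[OF this u[OF x]] show ?thesis
      by (simp add: algebra_simps)
  qed
  then obtain d where d: "\<And>x. x \<in> {a..b} \<Longrightarrow> ?v x = d"
    using has_vector_derivative_zero_constant[of "{a..b}" ?v] by auto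
  have "d = 0" using d[OF assms(2)] assms(3) by simp
  thus ?thesis using d[OF assms(4)] by simp
qed

text \<open>With \<open>h = s 0\<close>, the outermost factor \<open>D - c 0\<close> acts on \<open>u = q(D) h\<close>, where \<open>q\<close> is the product of the other factors.
  Its degree is \<open>m - 1\<close>, so the vanishing initial data give \<open>u(y) = 0\<close>, and \<open>q(D) h = u = 0\<close> is the
  same problem with one factor fewer.\<close>

lemma homogeneous_ivp_zero:
  assumes "derivative_tower a b m s"
    and "\<And>x. x \<in> {a..b} \<Longrightarrow> apply_poly (root_poly m c) (\<lambda>k. s k x) = 0"
    and "y \<in> {a..b}" "\<And>k. k < m \<Longrightarrow> s k y = 0" "x \<in> {a..b}"
  shows "s 0 x = 0"
  using assms
proof (induction m arbitrary: c x)
  case 0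
  thus ?case by (auto simp: apply_poly_def)
next
  case (Suc m)
  let ?q = "root_poly m (c \<circ> Suc)"
  let ?u = "\<lambda>x. apply_poly ?q (\<lambda>k. s k x)"
  have "?u x = 0" if "x \<in> {a..b}" for x
  proof (rule first_order_ode_zero)
    show "(?u has_vector_derivative c 0 * ?u x) (at x within {a..b})" if x: "x \<in> {a..b}" for x
    proof -
      have "apply_poly ?q (\<lambda>k. s (Suc k) x) = c 0 * ?u x"
        using Suc.prems(2)[OF x] by (simp only: root_poly_Suc apply_poly_linear_factor_mult) simp
      thus ?thesis
        using apply_poly_has_vector_derivative[OF Suc.prems(1) _ x, of ?q] by simp
    qed
    show "?u y = 0" using Suc.prems(4) by (simp add: apply_poly_def)
  qed (use that Suc.prems in auto)
  thus ?case
    using Suc.prems by (intro Suc.IH[of "c \<circ> Suc"])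
      (auto simp del: o_apply intro: derivative_tower_mono)
qed

section \<open>Iterated convolution of exponentials\<close>

text \<open>The chain with \<open>m\<close> integrations uses the \<open>m + 1\<close> exponents \<open>b 0, \<dots>, b m\<close>, numbered from the outermost
  variable inwards, so that dropping the first factor is the shift \<open>b \<circ> Suc\<close>.\<close>

primrec exp_chain :: "nat \<Rightarrow> (nat \<Rightarrow> complex) \<Rightarrow> real \<Rightarrow> real \<Rightarrow> complex" where
  "exp_chain 0 b y x = exp (b 0 * of_real (x - y))"
| "exp_chain (Suc m) b y x =
     (LBINT z=ereal y..ereal x. exp (b 0 * of_real (x - z)) * exp_chain m (b \<circ> Suc) y z)"

text \<open>The upper limit \<open>x\<close> may lie on either side of \<open>y\<close>. Going through a global antiderivative treats
  both orientations at once.\<close>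

lemma oriented_integral_has_vector_derivative:
  fixes f :: "real \<Rightarrow> complex"
  assumes "continuous_on UNIV f"
  shows "((\<lambda>x. LBINT z=ereal y..ereal x. f z) has_vector_derivative f x) (at x)"
proof -
  have "isCont f x" for x
    using assms by (simp add: continuous_on_eq_continuous_at)
  then obtain F where F: "\<And>x. (F has_vector_derivative f x) (at x)"
    using einterval_antiderivative[of "-\<infinity>" "\<infinity>" f] by auto
  have "(LBINT z=ereal y..ereal x. f z) = F x - F y" for x
    by (rule interval_integral_FTC_finite)
       (use assms F in \<open>auto intro: continuous_on_subset has_vector_derivative_at_within\<close>)
  moreover have "((\<lambda>x. F x - F y) has_vector_derivative f x) (at x)"
    using has_vector_derivative_diff[OF F has_vector_derivative_const] by simp
  ultimately show ?thesis by simp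
qed

text \<open>Applying \<open>D - b 0\<close> strips the outermost integration off the chain. The variable \<open>x\<close> occurs both as
  the limit and in the integrand; pulling \<open>exp (b 0 * x)\<close> out of the integral reduces the claim to the product rule.\<close>

lemma exp_chain_Suc_has_vector_derivative:
  assumes cont: "continuous_on UNIV (exp_chain m (b \<circ> Suc) y)"
  shows "(exp_chain (Suc m) b y has_vector_derivative
            b 0 * exp_chain (Suc m) b y x + exp_chain m (b \<circ> Suc) y x) (at x)"
proof -
  let ?g = "\<lambda>z. exp (- (b 0 * of_real z)) * exp_chain m (b \<circ> Suc) y z"
  let ?I = "\<lambda>x. LBINT z=ereal y..ereal x. ?g z"
  have eq: "exp_chain (Suc m) b y x = exp (b 0 * of_real x) * ?I x" for x
  proof -
    have "exp (b 0 * of_real (x - z)) = exp (b 0 * of_real x) * exp (- (b 0 * of_real z))" for z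
      by (simp add: right_diff_distrib flip: exp_add)
    thus ?thesis
      unfolding interval_lebesgue_integral_mult_right[symmetric] by (simp add: mult.assoc)
  qed
  have e: "((\<lambda>x::real. exp (b 0 * of_real x)) has_vector_derivative
          b 0 * exp (b 0 * of_real x)) (at x)"
    by (rule has_vector_derivative_real_field) (auto intro!: derivative_eq_intros)
  have I: "(?I has_vector_derivative ?g x) (at x)"
    by (rule oriented_integral_has_vector_derivative) (intro continuous_intros cont)
  have "((\<lambda>x. exp (b 0 * of_real x) * ?I x) has_vector_derivative
          exp (b 0 * of_real x) * ?g x + b 0 * exp (b 0 * of_real x) * ?I x) (at x)"
    by (rule has_vector_derivative_mult[OF e I])
  moreover have "exp (b 0 * of_real x) * ?g x = exp_chain m (b \<circ> Suc) y x"
    by (simp add: exp_minus)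
  ultimately show ?thesis
    unfolding eq[abs_def] by (simp only: add.commute mult.assoc)
qed

lemma exp_chain_0_has_vector_derivative:
  "(exp_chain 0 b y has_vector_derivative b 0 * exp_chain 0 b y x) (at x)"
proof -
  have "((\<lambda>x::real. exp (b 0 * (of_real x - of_real y))) has_vector_derivative
          b 0 * exp (b 0 * (of_real x - of_real y))) (at x)"
    by (rule has_vector_derivative_real_field) (auto intro!: derivative_eq_intros)
  thus ?thesis by (simp add: exp_chain.simps(1)[abs_def])
qed

lemma continuous_on_exp_chain: "continuous_on UNIV (exp_chain m b y)"
proof (induction m arbitrary: b)
  case 0
  show ?case
    by (rule continuous_on_vector_derivative)
       (rule has_vector_derivative_at_within[OF exp_chain_0_has_vector_derivative])
next
  case (Suc m)
  show ?case
    by (rule continuous_on_vector_derivative)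
       (rule has_vector_derivative_at_within[OF exp_chain_Suc_has_vector_derivative[OF Suc.IH]])
qed

text \<open>The \<open>k\<close>-th derivative of the chain in \<open>x\<close>, computed recursively: the derivative of a chain is \<open>b 0\<close> times
  the chain plus the chain without its outermost factor, the latter being absent for a single
  exponential.\<close>

fun chain_deriv :: "nat \<Rightarrow> (nat \<Rightarrow> complex) \<Rightarrow> real \<Rightarrow> nat \<Rightarrow> real \<Rightarrow> complex" where
  "chain_deriv m b y 0 x = exp_chain m b y x"
| "chain_deriv 0 b y (Suc k) x = b 0 * chain_deriv 0 b y k x"
| "chain_deriv (Suc m) b y (Suc k) x =
     b 0 * chain_deriv (Suc m) b y k x + chain_deriv m (b \<circ> Suc) y k x"

lemma chain_deriv_has_vector_derivative:
  "(chain_deriv m b y k has_vector_derivative chain_deriv m b y (Suc k) x) (at x)"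
proof (induction m arbitrary: b k)
  case 0
  show ?case
  proof (induction k)
    case 0
    show ?case
      using exp_chain_0_has_vector_derivative
      by (simp add: chain_deriv.simps(1)[abs_def] del: exp_chain.simps)
  next
    case (Suc k)
    have "((\<lambda>x. b 0 * chain_deriv 0 b y k x) has_vector_derivative
             b 0 * chain_deriv 0 b y (Suc k) x) (at x)"
      by (rule has_vector_derivative_mult_right[OF Suc])
    thus ?case by (simp add: chain_deriv.simps(2)[abs_def])
  qed
next
  case (Suc m)
  note IH = Suc.IH
  show ?case
  proof (induction k)
    case 0
    show ?case
      using exp_chain_Suc_has_vector_derivative[OF continuous_on_exp_chain]
      by (simp add: chain_deriv.simps(1)[abs_def] del: exp_chain.simps)
  next
    case (Suc k)
    have "((\<lambda>x. b 0 * chain_deriv (Suc m) b y k x + chain_deriv m (b \<circ> Suc) y k x)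
            has_vector_derivative
             b 0 * chain_deriv (Suc m) b y (Suc k) x + chain_deriv m (b \<circ> Suc) y (Suc k) x) (at x)"
      by (rule has_vector_derivative_add[OF has_vector_derivative_mult_right[OF Suc] IH])
    thus ?case by (simp add: chain_deriv.simps(3)[abs_def] del: exp_chain.simps)
  qed
qed

text \<open>At \<open>x = y\<close> every integral is over a point, so only the chain without integrations has a nonzero
  value there, namely \<open>1\<close>. Each differentiation can strip off one integral, hence it takes
  exactly \<open>m\<close> of them to reach that value; the other contributions are multiples of lower
  derivatives, which vanish.\<close>

lemma chain_deriv_initial:
  "k \<le> m \<Longrightarrow> chain_deriv m b y k y = (if k = m then 1 else 0)"
proof (induction m arbitrary: b k)
  case 0
  thus ?case by simp
next
  case (Suc m)
  note IH = Suc.IH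
  from Suc.prems show ?case
  proof (induction k)
    case 0
    show ?case by simp
  next
    case (Suc k)
    thus ?case by (simp add: IH)
  qed
qed

lemma root_poly_annihilates_chain:
  "apply_poly (root_poly (Suc m) b) (\<lambda>k. chain_deriv m b y k x) = 0"
proof (induction m arbitrary: b)
  case 0
  show ?case
    by (simp only: root_poly_Suc apply_poly_linear_factor_mult) (simp add: apply_poly_def)
next
  case (Suc m)
  let ?q = "root_poly (Suc m) (b \<circ> Suc)"
  have "apply_poly (root_poly (Suc (Suc m)) b) (\<lambda>k. chain_deriv (Suc m) b y k x) =
        apply_poly ?q (\<lambda>k. chain_deriv (Suc m) b y (Suc k) x - b 0 * chain_deriv (Suc m) b y k x)"
    by (subst root_poly_Suc)
       (simp only: apply_poly_linear_factor_mult apply_poly_diff apply_poly_scale)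
  also have "\<dots> = apply_poly ?q (\<lambda>k. chain_deriv m (b \<circ> Suc) y k x)"
    by simp
  also have "\<dots> = 0" by (rule Suc.IH)
  finally show ?case .
qed

section \<open>The iterated integral formula\<close>

lemma iterated_integral_scale:
  "iterated_integral m y x (\<lambda>zs. c * F zs) = c * iterated_integral m y x F"
  by (induction m arbitrary: x F) simp_all

text \<open>In the nested form of the integral all exponentials sit in the innermost integrand. The summand
  \<open>\<beta>\<^sub>1 (x - z\<^sub>1)\<close> is constant for the inner integrations and can be pulled out of them; what is left
  inside is the same expression with starting point \<open>z\<^sub>1\<close> and exponents \<open>\<beta>\<^sub>2, \<beta>\<^sub>3, \<dots>\<close>.\<close>

lemma iterated_integral_eq_exp_chain:
  "iterated_integral m y x
     (\<lambda>zs. let p = x # zs @ [y] in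
        exp (\<Sum>i=1..Suc m. \<beta> i * of_real (p ! (i - 1) - p ! i))) =
   exp_chain m (\<beta> \<circ> Suc) y x"
proof (induction m arbitrary: x \<beta>)
  case 0
  show ?case by simp
next
  case (Suc m)
  have split: "exp (\<Sum>i=1..Suc (Suc m). \<beta> i * of_real ((x # z # q) ! (i - 1) - (x # z # q) ! i)) =
      exp (\<beta> 1 * of_real (x - z)) *
      exp (\<Sum>i=1..Suc m. (\<beta> \<circ> Suc) i * of_real ((z # q) ! (i - 1) - (z # q) ! i))"
    for z :: real and q
  proof -
    have "(\<Sum>i=1..Suc (Suc m). \<beta> i * of_real ((x # z # q) ! (i - 1) - (x # z # q) ! i)) =
       \<beta> 1 * of_real (x - z) +
       (\<Sum>i=Suc 1..Suc (Suc m). \<beta> i * of_real ((x # z # q) ! (i - 1) - (x # z # q) ! i))"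
      by (subst sum.atLeast_Suc_atMost) (simp_all del: sum.cl_ivl_Suc)
    also have "(\<Sum>i=Suc 1..Suc (Suc m). \<beta> i * of_real ((x # z # q) ! (i - 1) - (x # z # q) ! i)) =
       (\<Sum>i=1..Suc m. (\<beta> \<circ> Suc) i * of_real ((z # q) ! (i - 1) - (z # q) ! i))"
      by (subst sum.shift_bounds_cl_Suc_ivl, rule sum.cong) (auto simp: nth_Cons')
    finally show ?thesis by (simp only: exp_add)
  qed
  have "iterated_integral m y z (\<lambda>zs. let p = x # (z # zs) @ [y] in
          exp (\<Sum>i=1..Suc (Suc m). \<beta> i * of_real (p ! (i - 1) - p ! i))) =
        exp (\<beta> 1 * of_real (x - z)) * exp_chain m (\<beta> \<circ> Suc \<circ> Suc) y z" for z
    using Suc.IH[of z "\<beta> \<circ> Suc"]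
    by (simp only: Let_def append_Cons split iterated_integral_scale)
  thus ?case
    by (simp only: iterated_integral.simps exp_chain.simps) simp
qed

section \<open>The causal Green's function\<close>

lemma poly_eq_root_poly:
  assumes "\<alpha> n \<noteq> 0"
    and "image_mset \<beta> (mset_set {1..n}) = proots (\<Sum>i\<le>n. monom (\<alpha> i) i)"
  shows "(\<Sum>i\<le>n. monom (\<alpha> i) i) = smult (\<alpha> n) (root_poly n (\<beta> \<circ> Suc))"
proof -
  let ?P = "\<Sum>i\<le>n. monom (\<alpha> i) i"
  have coeff: "coeff ?P k = (if k \<le> n then \<alpha> k else 0)" for k
    by (simp add: coeff_sum)
  have "degree ?P \<le> n" by (rule degree_le) (simp add: coeff)
  moreover have "n \<le> degree ?P" by (rule le_degree) (simp add: coeff assms)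
  ultimately have "lead_coeff ?P = \<alpha> n" by (simp add: coeff)
  moreover have "(\<Prod>x\<in>#proots ?P. [:-x, 1:]) = root_poly n (\<beta> \<circ> Suc)"
  proof -
    have "(\<Prod>x\<in>#proots ?P. [:-x, 1:]) = (\<Prod>i=1..n. [:- \<beta> i, 1:])"
      by (simp flip: assms(2) add: image_mset.compositionality o_def prod_unfold_prod_mset)
    also have "\<dots> = root_poly n (\<beta> \<circ> Suc)"
      unfolding root_poly_def
      by (rule prod.reindex_bij_witness[of _ Suc "\<lambda>i. i - 1"]) auto
    finally show ?thesis .
  qed
  ultimately show ?thesis
    using complex_poly_decompose_multiset[of ?P] by simp
qed

lemma constant_coeff_op_eq:
  assumes "\<alpha> n \<noteq> 0"
    and "image_mset \<beta> (mset_set {1..n}) = proots (\<Sum>i\<le>n. monom (\<alpha> i) i)"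
  shows "lin_diff_op a b n (\<lambda>k x. \<alpha> k) f x =
         \<alpha> n * apply_poly (root_poly n (\<beta> \<circ> Suc)) (\<lambda>k. nderiv a b k f x)"
proof -
  let ?P = "\<Sum>i\<le>n. monom (\<alpha> i) i"
  have coeff: "coeff ?P k = (if k \<le> n then \<alpha> k else 0)" for k
    by (simp add: coeff_sum)
  have "degree ?P \<le> n" by (rule degree_le) (simp add: coeff)
  hence "apply_poly ?P (\<lambda>k. nderiv a b k f x) = lin_diff_op a b n (\<lambda>k x. \<alpha> k) f x"
    by (simp add: apply_poly_bound[of ?P n] lin_diff_op_def coeff)
  thus ?thesis
    by (simp add: poly_eq_root_poly[OF assms] apply_poly_smult)
qed

theorem corollary2:
  fixes a b :: real and n :: nat and \<alpha> \<beta> :: "nat \<Rightarrow> complex"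
  assumes "a < b"
    and "n \<ge> 1"
    and "\<alpha> n \<noteq> 0"
    and "image_mset \<beta> (mset_set {1..n}) = proots (\<Sum>i\<le>n. monom (\<alpha> i) i)"
  shows "causal_greens_function a b n (\<lambda>k x. \<alpha> k)
    (\<lambda>x y. of_real (heaviside (x - y)) / \<alpha> n *
       iterated_integral (n - 1) y x
         (\<lambda>zs. let p = x # zs @ [y] in
            exp (\<Sum>i=1..n. \<beta> i * of_real (p ! (i - 1) - p ! i))))"
proof -
  obtain m where n: "n = Suc m" using assms(2) by (cases n) auto
  note op = constant_coeff_op_eq[OF assms(3,4)]
  define S where "S y k x = (1 / \<alpha> n) * chain_deriv m (\<beta> \<circ> Suc) y k x" for y k x
  define T where "T x y = S y 0 x" for x y
  have tower: "derivative_tower a b N (S y)" for y N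
    unfolding derivative_tower_def S_def
    by (intro allI impI ballI)
       (rule has_vector_derivative_mult_right[OF has_vector_derivative_at_within[OF
          chain_deriv_has_vector_derivative]])
  have cont: "continuous_on {a..b} (S y n)" for y
    by (rule continuous_on_vector_derivative[where f' = "S y (Suc n)"])
       (use tower[of "Suc n" y] in \<open>auto simp: derivative_tower_def\<close>)
  have nderiv_T: "nderiv a b k (\<lambda>x. T x y) x = S y k x" if "x \<in> {a..b}" for k x y
    using nderiv_eq_tower[OF assms(1) tower order_refl that] by (simp add: T_def[abs_def])
  have T: "causal_ivp a b n (\<lambda>k x. \<alpha> k) y (\<lambda>x. T x y)" if y: "y \<in> {a..b}" for y
    unfolding causal_ivp_def
  proof (intro conjI ballI allI impI)
    show "C_k_on n a b (\<lambda>x. T x y)"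
      using C_k_on_tower[OF assms(1) tower cont] by (simp add: T_def[abs_def])
    show "lin_diff_op a b n (\<lambda>k x. \<alpha> k) (\<lambda>x. T x y) x = 0" if "x \<in> {a..b}" for x
      using root_poly_annihilates_chain[of m "\<beta> \<circ> Suc" y x, folded n]
      by (simp only: op nderiv_T[OF that] S_def apply_poly_scale mult_zero_right)
  qed (use y in \<open>auto simp: nderiv_T S_def n chain_deriv_initial\<close>)
  have unique: "f x = T x y"
    if y: "y \<in> {a..b}" and f: "causal_ivp a b n (\<lambda>k x. \<alpha> k) y f" and x: "x \<in> {a..b}" for f x y
  proof -
    let ?h = "\<lambda>k x. nderiv a b k f x - nderiv a b k (\<lambda>x. T x y) x"
    have "?h 0 x = 0"
    proof (rule homogeneous_ivp_zero[OF _ _ y _ x])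
      show "derivative_tower a b n ?h"
        using f T[OF y] by (intro derivative_tower_diff tower_of_C_k_on) (auto simp: causal_ivp_def)
      show "apply_poly (root_poly n (\<beta> \<circ> Suc)) (\<lambda>k. ?h k x) = 0" if "x \<in> {a..b}" for x
        using f T[OF y] that assms(3) by (simp add: apply_poly_diff causal_ivp_def op)
      show "?h k y = 0" if "k < n" for k
        using f T[OF y] that by (cases "k = m") (auto simp: causal_ivp_def n)
    qed
    thus ?thesis by (simp add: nderiv_0)
  qed
  have G: "of_real (heaviside (x - y)) / \<alpha> n *
       iterated_integral (n - 1) y x
         (\<lambda>zs. let p = x # zs @ [y] in
            exp (\<Sum>i=1..n. \<beta> i * of_real (p ! (i - 1) - p ! i))) =
      T x y * of_real (heaviside (x - y))" for x y
    using iterated_integral_eq_exp_chain[of m y x \<beta>]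
    by (simp only: n diff_Suc_1 T_def S_def chain_deriv.simps) simp
  have "admissible_coeffs a b n (\<lambda>k x. \<alpha> k)"
    using assms by (auto simp: admissible_coeffs_def)
  thus ?thesis
    unfolding causal_greens_function_def using assms(1) T unique G by blast
qed

end
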